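(* Assume $K(x,y)>0$, $\mu(x)>0$, $\nu(y)>0$ for all $x,y\in S$. A point $g\in\mathcal H$ is an equilibrium of the flow $$\dot g_t=-\log\frac{m_{g_t}}{\nu}+\mathbb E_\nu\!\left[\log\frac{m_{g_t}}{\nu}\right]\mathbf 1$$ (that is, the right-hand side vanishes at $g$) if and only if $m_g=\nu$. The flow has exactly one equilibrium in $\mathcal H$, namely the unique $g^\star\in\mathcal H$ satisfying $m_{g^\star}=\nu$.
   Context: Let $N\ge1$ be an integer and $S=\{1,\dots,N\}$. Let $Q\in\mathbb R^{N\times N}$ be the generator of a continuous-time Markov chain on $S$ (nonnegative off-diagonal entries, rows summing to zero) and $K=e^{Q}$. Let $\mu,\nu$ be probability distributions on $S$. $\mathbf 1$ is the constant function $1$ on $S$; $\mathbb E_\nu[f]=\sum_{y\in S}\nu(y)f(y)$; $\log\frac{m}{\nu}$ is the function $y\mapsto\log(m(y)/\nu(y))$. For $g\in\mathbb R^S$ set $Z_g(x)=\sum_{z\in S}K(x,z)e^{g(z)}$, $p_g(y|x)=\frac{K(x,y)e^{g(y)}}{Z_g(x)}$, $m_g(y)=\sum_{x\in S}\mu(x)p_g(y|x)$ (a strictly positive probability distribution on $S$). The gauge-fixed space is $\mathcal H=\{g\in\mathbb R^S:\mathbb E_\nu[g]=0\}$. *)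

theory Defs
  imports "HOL-Analysis.Analysis"
begin

text \<open>
  The state space is a finite type \<open>'n\<close> with \<open>N = CARD('n) \<ge> 1\<close>; functions on it are
  vectors \<open>real ^ 'n\<close>, and a matrix entry \<open>A(x,y)\<close> is \<open>A $ x $ y\<close>.
\<close>

definition generator :: "real ^ 'n ^ 'n \<Rightarrow> bool" where
  "generator Q \<longleftrightarrow>
     (\<forall>x y. x \<noteq> y \<longrightarrow> 0 \<le> Q $ x $ y) \<and> (\<forall>x. (\<Sum>y\<in>UNIV. Q $ x $ y) = 0)"

definition prob_dist :: "real ^ 'n \<Rightarrow> bool" where
  "prob_dist p \<longleftrightarrow> (\<forall>x. 0 \<le> p $ x) \<and> (\<Sum>x\<in>UNIV. p $ x) = 1"

definition matrix_power :: "real ^ 'n ^ 'n \<Rightarrow> nat \<Rightarrow> real ^ 'n ^ 'n" where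
  "matrix_power A k = (((**) A) ^^ k) (mat 1)"

text \<open>
  The library's \<^const>\<open>exp\<close> is not available here, since \<open>real ^ 'n ^ 'n\<close> with \<open>(**)\<close> is not an
  instance of the normed-algebra classes. The series always converges: see
  \<open>matrix_exp_sums\<close> below.
\<close>

definition matrix_exp :: "real ^ 'n ^ 'n \<Rightarrow> real ^ 'n ^ 'n" where
  "matrix_exp A = (\<Sum>k. (1 / fact k) *\<^sub>R matrix_power A k)"

lemma matrix_power_entry_bound:
  fixes A :: "real ^ 'n ^ 'n"
  shows "\<bar>matrix_power A k $ x $ y\<bar> \<le> (\<Sum>i\<in>UNIV. \<Sum>j\<in>UNIV. \<bar>A $ i $ j\<bar>) ^ k"
proof (induction k arbitrary: x)
  case 0
  show ?case by (simp add: matrix_power_def mat_def)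
next
  case (Suc k)
  let ?c = "\<Sum>i\<in>UNIV. \<Sum>j\<in>UNIV. \<bar>A $ i $ j\<bar>"
  have c0: "0 \<le> ?c" by (intro sum_nonneg) auto
  have row: "(\<Sum>j\<in>UNIV. \<bar>A $ x $ j\<bar>) \<le> ?c"
    by (rule member_le_sum[where f = "\<lambda>i. \<Sum>j\<in>UNIV. \<bar>A $ i $ j\<bar>"]) (auto intro: sum_nonneg)
  have "matrix_power A (Suc k) $ x $ y = (\<Sum>j\<in>UNIV. A $ x $ j * matrix_power A k $ j $ y)"
    by (simp add: matrix_power_def matrix_matrix_mult_def)
  also have "\<bar>\<dots>\<bar> \<le> (\<Sum>j\<in>UNIV. \<bar>A $ x $ j\<bar> * \<bar>matrix_power A k $ j $ y\<bar>)"
    by (rule order_trans[OF sum_abs]) (simp add: abs_mult)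
  also have "\<dots> \<le> (\<Sum>j\<in>UNIV. \<bar>A $ x $ j\<bar> * ?c ^ k)"
    by (intro sum_mono mult_left_mono Suc.IH) auto
  also have "\<dots> = (\<Sum>j\<in>UNIV. \<bar>A $ x $ j\<bar>) * ?c ^ k"
    by (simp add: sum_distrib_right)
  also have "\<dots> \<le> ?c ^ Suc k"
    using mult_right_mono[OF row zero_le_power[OF c0]] by simp
  finally show ?case .
qed

lemma matrix_exp_sums:
  fixes A :: "real ^ 'n ^ 'n"
  shows "(\<lambda>k. (1 / fact k) *\<^sub>R matrix_power A k) sums matrix_exp A"
proof -
  let ?c = "\<Sum>i\<in>UNIV. \<Sum>j\<in>UNIV. \<bar>A $ i $ j\<bar>"
  let ?d = "real CARD('n) * real CARD('n)"
  have nrm: "norm (matrix_power A k) \<le> ?d * ?c ^ k" for k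
  proof -
    have "norm (matrix_power A k) \<le> (\<Sum>x\<in>UNIV. norm (matrix_power A k $ x))"
      by (simp add: norm_vec_def L2_set_le_sum)
    also have "\<dots> \<le> (\<Sum>x\<in>UNIV. \<Sum>y\<in>UNIV. \<bar>matrix_power A k $ x $ y\<bar>)"
      by (intro sum_mono norm_le_l1_cart)
    also have "\<dots> \<le> (\<Sum>x\<in>(UNIV::'n set). \<Sum>y\<in>(UNIV::'n set). ?c ^ k)"
      by (intro sum_mono matrix_power_entry_bound)
    finally show ?thesis by simp
  qed
  have "summable (\<lambda>k. ?d * (?c ^ k / fact k))"
    using summable_exp[of ?c] by (intro summable_mult) (simp add: field_simps)
  then have "summable (\<lambda>k. (1 / fact k) *\<^sub>R matrix_power A k)"
  proof (rule summable_comparison_test'[where N = 0])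
    fix k
    show "norm ((1 / fact k) *\<^sub>R matrix_power A k) \<le> ?d * (?c ^ k / fact k)"
      using divide_right_mono[OF nrm[of k], of "fact k"] by (simp add: divide_simps)
  qed
  then show ?thesis
    unfolding matrix_exp_def by (rule summable_sums)
qed

definition partition_fun :: "real ^ 'n ^ 'n \<Rightarrow> real ^ 'n \<Rightarrow> 'n \<Rightarrow> real" where
  "partition_fun K g x = (\<Sum>z\<in>UNIV. K $ x $ z * exp (g $ z))"

text \<open>\<open>cond_prob K g x y\<close> is the conditional probability \<open>p\<^sub>g(y|x)\<close>.\<close>

definition cond_prob :: "real ^ 'n ^ 'n \<Rightarrow> real ^ 'n \<Rightarrow> 'n \<Rightarrow> 'n \<Rightarrow> real" where
  "cond_prob K g x y = K $ x $ y * exp (g $ y) / partition_fun K g x"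

definition marginal :: "real ^ 'n ^ 'n \<Rightarrow> real ^ 'n \<Rightarrow> real ^ 'n \<Rightarrow> real ^ 'n" where
  "marginal K \<mu> g = (\<chi> y. \<Sum>x\<in>UNIV. \<mu> $ x * cond_prob K g x y)"

definition expect :: "real ^ 'n \<Rightarrow> real ^ 'n \<Rightarrow> real" where
  "expect \<nu> f = (\<Sum>y\<in>UNIV. \<nu> $ y * f $ y)"

definition gauge_space :: "real ^ 'n \<Rightarrow> (real ^ 'n) set" where
  "gauge_space \<nu> = {g. expect \<nu> g = 0}"

definition log_ratio :: "real ^ 'n \<Rightarrow> real ^ 'n \<Rightarrow> real ^ 'n" where
  "log_ratio m \<nu> = (\<chi> y. ln (m $ y / \<nu> $ y))"

text \<open>The right-hand side of the flow; \<^term>\<open>vec 1\<close> is the constant function 1.\<close>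

definition flow_field :: "real ^ 'n ^ 'n \<Rightarrow> real ^ 'n \<Rightarrow> real ^ 'n \<Rightarrow> real ^ 'n \<Rightarrow> real ^ 'n" where
  "flow_field K \<mu> \<nu> g =
     - log_ratio (marginal K \<mu> g) \<nu> + expect \<nu> (log_ratio (marginal K \<mu> g) \<nu>) *\<^sub>R vec 1"

definition equilibrium :: "real ^ 'n ^ 'n \<Rightarrow> real ^ 'n \<Rightarrow> real ^ 'n \<Rightarrow> real ^ 'n \<Rightarrow> bool" where
  "equilibrium K \<mu> \<nu> g \<longleftrightarrow> flow_field K \<mu> \<nu> g = 0"

end

theory Submission
  imports Defs
begin

text \<open>
  The field vanishes at \<open>g\<close> exactly when \<open>ln (m\<^sub>g / \<nu>)\<close> is constant, i.e. when \<open>m\<^sub>g\<close> and \<open>\<nu>\<close> are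
  proportional; both have total mass 1, so this means \<open>m\<^sub>g = \<nu>\<close> (\<open>equilibrium_iff_marginal\<close>).
  It remains to see that \<open>g \<mapsto> m\<^sub>g\<close> takes the value \<open>\<nu>\<close> exactly once on the gauge space.

  Existence is variational. The function \<open>J g = (\<Sum>x. \<mu> x * ln (Z\<^sub>g x)) - E\<^sub>\<nu> g\<close> (the negative of the
  semi-dual objective of entropic optimal transport) has gradient \<open>m\<^sub>g - \<nu>\<close>, so its minimizers
  solve \<open>m\<^sub>g = \<nu>\<close>. It is invariant under adding constants to \<open>g\<close>, and on the gauge space its
  sublevel sets are bounded (\<open>dual_sublevel_bounded\<close>), so a global minimizer exists in the gauge
  space.

  Uniqueness is a maximum principle (\<open>marginal_eq_imp_diff_const\<close>): when passing from \<open>g\<close> to \<open>h\<close>,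
  a point where \<open>h - g\<close> is maximal gains mass from every source \<open>x\<close>, unless \<open>h - g\<close> is constant;
  and the only constant in the gauge space is 0.
\<close>

section \<open>The marginal distribution\<close>

lemma partition_fun_pos:
  fixes K :: "real ^ 'n ^ 'n"
  assumes "\<forall>x y. K $ x $ y > 0"
  shows "partition_fun K g x > 0"
  unfolding partition_fun_def using assms by (intro sum_pos) auto

lemma marginal_pos:
  fixes K :: "real ^ 'n ^ 'n"
  assumes "\<forall>x y. K $ x $ y > 0" "\<forall>x. \<mu> $ x > 0"
  shows "marginal K \<mu> g $ y > 0"
  unfolding marginal_def cond_prob_def using assms partition_fun_pos[OF assms(1)]
  by (auto intro!: sum_pos)

lemma sum_cond_prob:
  fixes K :: "real ^ 'n ^ 'n"
  assumes "\<forall>x y. K $ x $ y > 0"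
  shows "(\<Sum>y\<in>UNIV. cond_prob K g x y) = 1"
  using partition_fun_pos[OF assms, of g x]
  by (simp add: cond_prob_def partition_fun_def flip: sum_divide_distrib)

lemma expect_marginal:
  "expect (marginal K \<mu> g) v = (\<Sum>x\<in>UNIV. \<mu> $ x * (\<Sum>y\<in>UNIV. cond_prob K g x y * v $ y))"
proof -
  have "expect (marginal K \<mu> g) v = (\<Sum>y\<in>UNIV. \<Sum>x\<in>UNIV. \<mu> $ x * (cond_prob K g x y * v $ y))"
    by (simp add: expect_def marginal_def sum_distrib_right mult.assoc)
  also have "\<dots> = (\<Sum>x\<in>UNIV. \<Sum>y\<in>UNIV. \<mu> $ x * (cond_prob K g x y * v $ y))"
    by (rule sum.swap)
  finally show ?thesis by (simp add: sum_distrib_left)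
qed

lemma sum_marginal:
  fixes K :: "real ^ 'n ^ 'n"
  assumes "\<forall>x y. K $ x $ y > 0" "prob_dist \<mu>"
  shows "(\<Sum>y\<in>UNIV. marginal K \<mu> g $ y) = 1"
  using expect_marginal[of K \<mu> g "vec 1"] sum_cond_prob[OF assms(1)] assms(2)
  by (simp add: expect_def prob_dist_def)

lemma equilibrium_iff_marginal:
  fixes K :: "real ^ 'n ^ 'n"
  assumes K: "\<forall>x y. K $ x $ y > 0" and \<mu>: "prob_dist \<mu>" "\<forall>x. \<mu> $ x > 0"
    and \<nu>: "prob_dist \<nu>" "\<forall>y. \<nu> $ y > 0"
  shows "equilibrium K \<mu> \<nu> g \<longleftrightarrow> marginal K \<mu> g = \<nu>"
proof
  let ?m = "marginal K \<mu> g"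
  assume "equilibrium K \<mu> \<nu> g"
  then have "log_ratio ?m \<nu> = expect \<nu> (log_ratio ?m \<nu>) *\<^sub>R vec 1"
    by (simp add: equilibrium_def flow_field_def)
  then have "log_ratio ?m \<nu> $ y = expect \<nu> (log_ratio ?m \<nu>)" for y
    by (metis mult.right_neutral real_scaleR_def vec_component vector_scaleR_component)
  then have const: "ln (?m $ y / \<nu> $ y) = expect \<nu> (log_ratio ?m \<nu>)" for y
    by (metis log_ratio_def vec_lambda_beta)
  define c where "c = exp (expect \<nu> (log_ratio ?m \<nu>))"
  have prop_eq: "?m $ y = c * \<nu> $ y" for y
  proof -
    have "?m $ y / \<nu> $ y > 0" using marginal_pos[OF K \<mu>(2)] \<nu>(2) by simp
    then have "?m $ y / \<nu> $ y = c" unfolding c_def const[of y, symmetric] by simp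
    then show ?thesis using \<nu>(2)[rule_format, of y] by (simp add: field_simps)
  qed
  have "1 = c * (\<Sum>y\<in>UNIV. \<nu> $ y)"
    using sum_marginal[OF K \<mu>(1), of g] by (simp add: prop_eq sum_distrib_left)
  then have "c = 1" using \<nu>(1) by (simp add: prob_dist_def)
  then show "?m = \<nu>" by (simp add: vec_eq_iff prop_eq)
next
  assume "marginal K \<mu> g = \<nu>"
  moreover have "\<nu> $ y \<noteq> 0" for y using \<nu>(2)[rule_format, of y] by simp
  then have "log_ratio \<nu> \<nu> = 0" by (simp add: log_ratio_def vec_eq_iff)
  ultimately show "equilibrium K \<mu> \<nu> g"
    by (simp add: equilibrium_def flow_field_def expect_def)
qed

section \<open>Uniqueness\<close>

text \<open>
  Let \<open>D\<close> be the maximum of \<open>h - g\<close>, attained at \<open>y\<close>. The numerator of \<open>p(y|x)\<close> grows by the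
  factor \<open>exp D\<close>, whereas \<open>Z(x)\<close> grows by a weighted mean of the \<open>exp ((h - g) z)\<close>, which is
  strictly smaller unless \<open>h - g\<close> is constant. Hence the mass at \<open>y\<close> would strictly increase.
\<close>

lemma marginal_eq_imp_diff_const:
  fixes K :: "real ^ 'n ^ 'n"
  assumes K: "\<forall>x y. K $ x $ y > 0" and \<mu>: "\<forall>x. \<mu> $ x > 0"
    and eq: "marginal K \<mu> g = marginal K \<mu> h"
  shows "\<exists>D. \<forall>z. h $ z - g $ z = D"
proof (rule ccontr)
  assume nonconst: "\<not> ?thesis"
  define D where "D = Max (range (\<lambda>z. h $ z - g $ z))"
  have le: "h $ z - g $ z \<le> D" for z unfolding D_def by (rule Max_ge) auto
  have "D \<in> range (\<lambda>z. h $ z - g $ z)" unfolding D_def by (rule Max_in) auto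
  then obtain y where "D = h $ y - g $ y" by blast
  then have y: "h $ y = g $ y + D" by simp
  obtain w where "h $ w - g $ w \<noteq> D" using nonconst by blast
  then have w: "h $ w < D + g $ w" using le[of w] by simp
  have Z: "partition_fun K h x < exp D * partition_fun K g x" for x
  proof -
    have "(\<Sum>z\<in>UNIV. K $ x $ z * exp (h $ z)) < (\<Sum>z\<in>UNIV. K $ x $ z * exp (D + g $ z))"
    proof (rule sum_strict_mono_ex1)
      show "\<forall>z\<in>UNIV. K $ x $ z * exp (h $ z) \<le> K $ x $ z * exp (D + g $ z)"
        using K le by (simp add: algebra_simps)
      show "\<exists>z\<in>UNIV. K $ x $ z * exp (h $ z) < K $ x $ z * exp (D + g $ z)"
        using K w by (intro bexI[of _ w]) auto
    qed simp
    then show ?thesis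
      by (simp add: partition_fun_def exp_add sum_distrib_left mult.left_commute)
  qed
  have "cond_prob K g x y < cond_prob K h x y" for x
  proof -
    have "cond_prob K g x y = K $ x $ y * exp (h $ y) / (exp D * partition_fun K g x)"
      by (simp add: cond_prob_def y exp_add)
    also have "\<dots> < K $ x $ y * exp (h $ y) / partition_fun K h x"
      using K Z[of x] partition_fun_pos[OF K, of _ x] by (intro divide_strict_left_mono) auto
    finally show ?thesis by (simp add: cond_prob_def)
  qed
  then have "marginal K \<mu> g $ y < marginal K \<mu> h $ y"
    unfolding marginal_def using \<mu> by (auto intro!: sum_strict_mono)
  then show False using eq by simp
qed

lemma marginal_inj_on_gauge:
  fixes K :: "real ^ 'n ^ 'n"
  assumes K: "\<forall>x y. K $ x $ y > 0" and \<mu>: "\<forall>x. \<mu> $ x > 0" and \<nu>: "prob_dist \<nu>"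
  shows "inj_on (marginal K \<mu>) (gauge_space \<nu>)"
proof (rule inj_onI)
  fix g h assume gh: "g \<in> gauge_space \<nu>" "h \<in> gauge_space \<nu>"
    and eq: "marginal K \<mu> g = marginal K \<mu> h"
  obtain D where "\<forall>z. h $ z - g $ z = D"
    using marginal_eq_imp_diff_const[OF K \<mu> eq] by blast
  then have D: "h $ z = g $ z + D" for z by (simp add: algebra_simps)
  have "expect \<nu> h = expect \<nu> g + (\<Sum>z\<in>UNIV. \<nu> $ z) * D"
    by (simp add: expect_def D distrib_left sum.distrib sum_distrib_right)
  then have "D = 0" using gh \<nu> by (simp add: gauge_space_def prob_dist_def)
  then show "g = h" by (simp add: vec_eq_iff D)
qed

section \<open>The dual functional and its minimizer\<close>

definition dual_functional ::
    "real ^ 'n ^ 'n \<Rightarrow> real ^ 'n \<Rightarrow> real ^ 'n \<Rightarrow> real ^ 'n \<Rightarrow> real" where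
  "dual_functional K \<mu> \<nu> g = (\<Sum>x\<in>UNIV. \<mu> $ x * ln (partition_fun K g x)) - expect \<nu> g"

lemma expect_add_scaled:
  "expect \<nu> (g + t *\<^sub>R v) = expect \<nu> g + t * expect \<nu> v"
  by (simp add: expect_def distrib_left sum.distrib sum_distrib_left mult.left_commute)

lemma dual_functional_add_const:
  fixes K :: "real ^ 'n ^ 'n"
  assumes "\<forall>x y. K $ x $ y > 0" "prob_dist \<mu>" "prob_dist \<nu>"
  shows "dual_functional K \<mu> \<nu> (g + c *\<^sub>R vec 1) = dual_functional K \<mu> \<nu> g"
proof -
  have "partition_fun K (g + c *\<^sub>R vec 1) x = partition_fun K g x * exp c" for x
    by (simp add: partition_fun_def exp_add sum_distrib_right mult.assoc)
  then have "ln (partition_fun K (g + c *\<^sub>R vec 1) x) = ln (partition_fun K g x) + c" for x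
    using partition_fun_pos[OF assms(1), of g x] by (simp add: ln_mult)
  moreover have "expect \<nu> (vec 1) = 1" using assms(3) by (simp add: expect_def prob_dist_def)
  ultimately show ?thesis using assms(2)
    by (simp add: dual_functional_def expect_add_scaled distrib_left sum.distrib prob_dist_def
        flip: sum_distrib_right)
qed

lemma continuous_on_dual_functional:
  fixes K :: "real ^ 'n ^ 'n"
  assumes "\<forall>x y. K $ x $ y > 0"
  shows "continuous_on A (dual_functional K \<mu> \<nu>)"
proof -
  have "(\<Sum>z\<in>UNIV. K $ x $ z * exp (g $ z)) \<noteq> 0" for x g
    using partition_fun_pos[OF assms, of g x] by (simp add: partition_fun_def)
  then show ?thesis
    unfolding dual_functional_def[abs_def] partition_fun_def expect_def
    by (intro continuous_intros) auto
qed

lemma dual_functional_directional_derivative: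
  fixes K :: "real ^ 'n ^ 'n"
  assumes "\<forall>x y. K $ x $ y > 0"
  shows "((\<lambda>t. dual_functional K \<mu> \<nu> (g + t *\<^sub>R v)) has_real_derivative
           expect (marginal K \<mu> g) v - expect \<nu> v) (at 0)"
proof -
  have Z: "((\<lambda>t. partition_fun K (g + t *\<^sub>R v) x) has_real_derivative
          (\<Sum>z\<in>UNIV. K $ x $ z * (exp (g $ z) * v $ z))) (at 0)" for x
    unfolding partition_fun_def by (auto intro!: derivative_eq_intros sum.cong)
  have lnZ: "((\<lambda>t. ln (partition_fun K (g + t *\<^sub>R v) x)) has_real_derivative
          (\<Sum>z\<in>UNIV. cond_prob K g x z * v $ z)) (at 0)" for x
    using partition_fun_pos[OF assms, of g x]
    by (auto intro!: derivative_eq_intros Z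
        simp: cond_prob_def sum_divide_distrib mult.assoc)
  have "((\<lambda>t. \<Sum>x\<in>UNIV. \<mu> $ x * ln (partition_fun K (g + t *\<^sub>R v) x)) has_real_derivative
          (\<Sum>x\<in>UNIV. \<mu> $ x * (\<Sum>z\<in>UNIV. cond_prob K g x z * v $ z))) (at 0)"
    by (intro DERIV_sum DERIV_cmult lnZ)
  moreover have "((\<lambda>t. expect \<nu> g + t * expect \<nu> v) has_real_derivative expect \<nu> v) (at 0)"
    by (auto intro!: derivative_eq_intros)
  ultimately have "((\<lambda>t. (\<Sum>x\<in>UNIV. \<mu> $ x * ln (partition_fun K (g + t *\<^sub>R v) x))
            - (expect \<nu> g + t * expect \<nu> v)) has_real_derivative
          (\<Sum>x\<in>UNIV. \<mu> $ x * (\<Sum>z\<in>UNIV. cond_prob K g x z * v $ z)) - expect \<nu> v) (at 0)"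
    by (rule DERIV_diff)
  then show ?thesis
    by (simp add: dual_functional_def expect_add_scaled expect_marginal)
qed

text \<open>
  A single summand bounds the partition function from below: \<open>Z\<^sub>g(x) \<ge> K(x,y) * exp (g y)\<close>. Averaging
  logarithms over \<open>\<mu>\<close> gives \<open>J g \<ge> (\<Sum>x. \<mu> x * ln (K(x,y))) + g y\<close> on the gauge space, hence an upper
  bound on each coordinate; the gauge condition turns upper bounds into lower ones.
\<close>

lemma dual_sublevel_bounded:
  fixes K :: "real ^ 'n ^ 'n"
  assumes K: "\<forall>x y. K $ x $ y > 0" and \<mu>: "prob_dist \<mu>" and \<nu>: "\<forall>y. \<nu> $ y > 0"
  shows "\<exists>a b. \<forall>g\<in>gauge_space \<nu>. dual_functional K \<mu> \<nu> g \<le> C \<longrightarrow> g \<in> cbox a b"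
proof -
  define M :: "real ^ 'n" where "M = (\<chi> y. C - (\<Sum>x\<in>UNIV. \<mu> $ x * ln (K $ x $ y)))"
  define L :: "real ^ 'n" where "L = (\<chi> y. M $ y - expect \<nu> M / \<nu> $ y)"
  have "g \<in> cbox L M" if g: "g \<in> gauge_space \<nu>" and J: "dual_functional K \<mu> \<nu> g \<le> C" for g
  proof -
    have g0: "expect \<nu> g = 0" using g by (simp add: gauge_space_def)
    have upper: "g $ y \<le> M $ y" for y
    proof -
      have lnZ: "ln (K $ x $ y) + g $ y \<le> ln (partition_fun K g x)" for x
      proof -
        have "K $ x $ y * exp (g $ y) \<le> partition_fun K g x"
          unfolding partition_fun_def using K
          by (intro member_le_sum[where f = "\<lambda>z. K $ x $ z * exp (g $ z)"]) (auto simp: less_imp_le)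
        moreover have "0 < K $ x $ y * exp (g $ y)" using K by simp
        ultimately have "ln (K $ x $ y * exp (g $ y)) \<le> ln (partition_fun K g x)"
          by (meson ln_mono order_less_le_trans)
        then show ?thesis using K[rule_format, of x y] by (simp add: ln_mult)
      qed
      have "(\<Sum>x\<in>UNIV. \<mu> $ x * ln (K $ x $ y)) + g $ y
          = (\<Sum>x\<in>UNIV. \<mu> $ x * (ln (K $ x $ y) + g $ y))"
        using \<mu> by (simp add: distrib_left sum.distrib prob_dist_def flip: sum_distrib_right)
      also have "\<dots> \<le> (\<Sum>x\<in>UNIV. \<mu> $ x * ln (partition_fun K g x))"
        using \<mu> lnZ by (intro sum_mono mult_left_mono) (auto simp: prob_dist_def)
      also have "\<dots> \<le> C" using J g0 by (simp add: dual_functional_def)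
      finally show ?thesis by (simp add: M_def)
    qed
    have lower: "L $ y \<le> g $ y" for y
    proof -
      have "\<nu> $ y * (M $ y - g $ y) \<le> (\<Sum>z\<in>UNIV. \<nu> $ z * (M $ z - g $ z))"
        using \<nu> upper
        by (intro member_le_sum[where f = "\<lambda>z. \<nu> $ z * (M $ z - g $ z)"]) (auto simp: less_imp_le)
      also have "\<dots> = expect \<nu> M"
        using g0 by (simp add: right_diff_distrib sum_subtractf expect_def)
      finally show ?thesis
        using \<nu>[rule_format, of y] by (simp add: L_def field_simps)
    qed
    show ?thesis using upper lower by (simp add: mem_box_cart)
  qed
  then show ?thesis by blast
qed

lemma dual_functional_minimizer:
  fixes K :: "real ^ 'n ^ 'n"
  assumes K: "\<forall>x y. K $ x $ y > 0" and \<mu>: "prob_dist \<mu>"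
    and \<nu>: "prob_dist \<nu>" "\<forall>y. \<nu> $ y > 0"
  obtains g where "g \<in> gauge_space \<nu>" "\<And>h. dual_functional K \<mu> \<nu> g \<le> dual_functional K \<mu> \<nu> h"
proof -
  let ?J = "dual_functional K \<mu> \<nu>"
  obtain a b where ab: "\<And>g. g \<in> gauge_space \<nu> \<Longrightarrow> ?J g \<le> ?J 0 \<Longrightarrow> g \<in> cbox a b"
    using dual_sublevel_bounded[OF K \<mu> \<nu>(2)] by metis
  have zero: "0 \<in> gauge_space \<nu>" by (simp add: gauge_space_def expect_def)
  have "closed (gauge_space \<nu>)"
    unfolding gauge_space_def expect_def by (intro closed_Collect_eq continuous_intros)
  then have "compact (cbox a b \<inter> gauge_space \<nu>)" by (intro compact_Int_closed compact_cbox)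
  moreover have "cbox a b \<inter> gauge_space \<nu> \<noteq> {}" using zero ab[OF zero] by auto
  ultimately obtain g where g: "g \<in> gauge_space \<nu>"
    and min: "\<And>h. h \<in> cbox a b \<inter> gauge_space \<nu> \<Longrightarrow> ?J g \<le> ?J h"
    using continuous_attains_inf[OF _ _ continuous_on_dual_functional[OF K]] by (metis IntD2)
  have gauge: "?J g \<le> ?J h" if "h \<in> gauge_space \<nu>" for h
    using min[of h] min[of 0] ab[of h] ab[of 0] zero that by (cases "?J h \<le> ?J 0") auto
  have "?J g \<le> ?J h" for h
  proof -
    let ?h = "h + (- expect \<nu> h) *\<^sub>R vec 1"
    have "expect \<nu> (vec 1) = 1" using \<nu>(1) by (simp add: expect_def prob_dist_def)
    then have "?h \<in> gauge_space \<nu>" unfolding gauge_space_def expect_add_scaled mem_Collect_eq by simp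
    then have "?J g \<le> ?J ?h" by (rule gauge)
    then show ?thesis unfolding dual_functional_add_const[OF K \<mu> \<nu>(1)] .
  qed
  then show thesis using that g by blast
qed

text \<open>Testing criticality in the direction of the gradient \<open>m\<^sub>g - \<nu>\<close> itself shows that it vanishes.\<close>

lemma dual_minimizer_marginal:
  fixes K :: "real ^ 'n ^ 'n"
  assumes K: "\<forall>x y. K $ x $ y > 0"
    and min: "\<And>h. dual_functional K \<mu> \<nu> g \<le> dual_functional K \<mu> \<nu> h"
  shows "marginal K \<mu> g = \<nu>"
proof -
  let ?m = "marginal K \<mu> g"
  let ?v = "?m - \<nu>"
  have "expect ?m ?v - expect \<nu> ?v = 0"
    using DERIV_local_min[OF dual_functional_directional_derivative[OF K], of 1] min by simp
  moreover have "expect ?m ?v - expect \<nu> ?v = ?v \<bullet> ?v"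
    by (simp add: expect_def inner_vec_def left_diff_distrib flip: sum_subtractf)
  ultimately show ?thesis by simp
qed

section \<open>Equilibria of the flow\<close>

theorem mainTheorem7:
  fixes Q K :: "real ^ 'n ^ 'n" and \<mu> \<nu> :: "real ^ 'n"
  assumes "generator Q"
    and "K = matrix_exp Q"
    and "prob_dist \<mu>" and "prob_dist \<nu>"
    and "\<forall>x y. K $ x $ y > 0"
    and "\<forall>x. \<mu> $ x > 0"
    and "\<forall>y. \<nu> $ y > 0"
  shows "(\<forall>g\<in>gauge_space \<nu>. equilibrium K \<mu> \<nu> g \<longleftrightarrow> marginal K \<mu> g = \<nu>) \<and>
    (\<exists>gstar\<in>gauge_space \<nu>.
       marginal K \<mu> gstar = \<nu> \<and>
       (\<forall>g\<in>gauge_space \<nu>. marginal K \<mu> g = \<nu> \<longrightarrow> g = gstar) \<and>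
       {g \<in> gauge_space \<nu>. equilibrium K \<mu> \<nu> g} = {gstar})"
proof -
  note K = assms(5)
  have iff: "equilibrium K \<mu> \<nu> g \<longleftrightarrow> marginal K \<mu> g = \<nu>" for g
    using equilibrium_iff_marginal[OF K] assms by blast
  obtain gs where gs: "gs \<in> gauge_space \<nu>" "marginal K \<mu> gs = \<nu>"
    using dual_functional_minimizer[OF K assms(3,4,7)] dual_minimizer_marginal[OF K] by metis
  have uniq: "g = gs" if "g \<in> gauge_space \<nu>" "marginal K \<mu> g = \<nu>" for g
    using inj_onD[OF marginal_inj_on_gauge[OF K assms(6,4)], of g gs] that gs by simp
  show ?thesis using iff gs uniq by auto
qed

end
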